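(* Let $d,N\in\mathbb N$, $M\in2\mathbb N$ and points $\boldsymbol x_j\in[-\tfrac12,\tfrac12)^d$, $j=1,\dots,N$, be given, and let $\boldsymbol A=\left(\mathrm e^{2\pi\mathrm i\boldsymbol k\boldsymbol x_j}\right)_{j=1,\,\boldsymbol k\in\mathcal I_{\boldsymbol M}}^{N}\in\mathbb C^{N\times|\mathcal I_{\boldsymbol M}|}$. Let density compensation factors $\boldsymbol w=(w_j)_{j=1}^N\in\mathbb C^N$, $\boldsymbol W=\mathrm{diag}(w_j)_{j=1}^N$, be computed by the weight procedure described in the context such that $$\sum_{j=1}^N w_j\,\mathrm e^{2\pi\mathrm i\boldsymbol k\boldsymbol x_j}=\delta_{\boldsymbol 0,\boldsymbol k}+\varepsilon_{\boldsymbol k},\qquad\boldsymbol k\in\mathcal I_{\boldsymbol{2M}},$$ with $\varepsilon_{\boldsymbol k}\in\mathbb R$, and let $\varepsilon=\max_{\boldsymbol k\in\mathcal I_{\boldsymbol{2M}}}|\varepsilon_{\boldsymbol k}|\ge0$. If additionally $\varepsilon\,|\mathcal I_{\boldsymbol M}|<1$, then $$1\le\kappa_2(\boldsymbol A^*\boldsymbol W\boldsymbol A)\le\frac{1+\varepsilon\,|\mathcal I_{\boldsymbol M}|}{1-\varepsilon\,|\mathcal I_{\boldsymbol M}|}$$ for the condition number $\kappa_2(\boldsymbol X):=\|\boldsymbol X\|_2\,\|\boldsymbol X^{-1}\|_2$.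
   Context: For $M\in2\mathbb N$: $\mathcal I_{\boldsymbol M}:=\mathbb Z^d\cap[-\tfrac M2,\tfrac M2)^d$ with $|\mathcal I_{\boldsymbol M}|=M^d$, and $\mathcal I_{\boldsymbol{2M}}:=\mathbb Z^d\cap[-M,M)^d$; $\boldsymbol k\boldsymbol x=k_1x_1+\dots+k_dx_d$. $\boldsymbol A^*$ is the conjugate transpose; $\|\cdot\|_2$ is the spectral norm. Weight procedure: let $\boldsymbol A_{|\mathcal I_{\boldsymbol{2M}}|}=\left(\mathrm e^{2\pi\mathrm i\boldsymbol k\boldsymbol x_j}\right)_{j=1,\,\boldsymbol k\in\mathcal I_{\boldsymbol{2M}}}^{N}$ and $\boldsymbol e_{\boldsymbol 0}=(\delta_{\boldsymbol 0,\boldsymbol k})_{\boldsymbol k\in\mathcal I_{\boldsymbol{2M}}}$. If $|\mathcal I_{\boldsymbol{2M}}|\le N$, one computes (iteratively) $\boldsymbol v$ from $\boldsymbol A_{|\mathcal I_{\boldsymbol{2M}}|}^T\overline{\boldsymbol A_{|\mathcal I_{\boldsymbol{2M}}|}}\,\boldsymbol v=\boldsymbol e_{\boldsymbol 0}$ and sets $\boldsymbol w=\overline{\boldsymbol A_{|\mathcal I_{\boldsymbol{2M}}|}}\,\boldsymbol v$. If $|\mathcal I_{\boldsymbol{2M}}|>N$, one computes (iteratively) $\boldsymbol w$ from the normal equations $\overline{\boldsymbol A_{|\mathcal I_{\boldsymbol{2M}}|}}\,\boldsymbol A_{|\mathcal I_{\boldsymbol{2M}}|}^T\,\boldsymbol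 w=\overline{\boldsymbol A_{|\mathcal I_{\boldsymbol{2M}}|}}\,\boldsymbol e_{\boldsymbol 0}$. The numbers $\varepsilon_{\boldsymbol k}$ are the resulting residuals. *)

theory Defs
  imports
    "HOL-Analysis.L2_Norm"
    "Jordan_Normal_Form.Gauss_Jordan_Elimination"
    "Jordan_Normal_Form.Schur_Decomposition"
begin

text \<open>The index set of integer vectors in \<open>[- M / 2, M / 2)\<^sup>d\<close>; the doubled index set
  \<open>[- M, M)\<^sup>d\<close> is \<open>freq_set d (2 * M)\<close>.\<close>

definition freq_set :: "nat \<Rightarrow> nat \<Rightarrow> int vec set" where
  "freq_set d M =
     {k \<in> carrier_vec d.
        \<forall>i<d. - (real M / 2) \<le> real_of_int (k $ i) \<and> real_of_int (k $ i) < real M / 2}"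

definition fourier_char :: "int vec \<Rightarrow> real vec \<Rightarrow> complex" where
  "fourier_char k x =
     exp (2 * complex_of_real pi * \<i> * complex_of_real (map_vec real_of_int k \<bullet> x))"

text \<open>Columns are indexed by frequencies, so an ordering of the index set is needed: it is given
  by a list \<open>ks\<close>. Rows are indexed by \<open>j < N\<close> instead of \<open>1, \<dots>, N\<close>.\<close>

definition fourier_mat :: "nat \<Rightarrow> (nat \<Rightarrow> real vec) \<Rightarrow> int vec list \<Rightarrow> complex mat" where
  "fourier_mat N x ks = mat N (length ks) (\<lambda>(j, l). fourier_char (ks ! l) (x j))"

definition l2_norm_vec :: "complex vec \<Rightarrow> real" where
  "l2_norm_vec v = L2_set (\<lambda>i. cmod (v $ i)) {..<dim_vec v}"

definition spectral_norm :: "complex mat \<Rightarrow> real" where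
  "spectral_norm X =
     Sup {l2_norm_vec (X *\<^sub>v v) | v. v \<in> carrier_vec (dim_col X) \<and> l2_norm_vec v = 1}"

text \<open>Only meaningful for invertible \<open>X\<close>, since \<open>mat_inverse X = None\<close> otherwise.\<close>

definition cond_num2 :: "complex mat \<Rightarrow> real" where
  "cond_num2 X = spectral_norm X * spectral_norm (the (mat_inverse X))"

text \<open>\<open>w\<close> is an output of the weight procedure for the points \<open>x 0, \<dots>, x (N - 1)\<close>, where \<open>ls\<close>
  lists the frequencies of the doubled index set. The linear systems are solved iteratively, hence
  only approximately: the iteration stops with a residual of norm at most \<open>tol\<close>, and \<open>tol = 0\<close> is
  the case of exact solutions.\<close>

definition density_weights ::
  "real \<Rightarrow> nat \<Rightarrow> nat \<Rightarrow> (nat \<Rightarrow> real vec) \<Rightarrow> int vec list \<Rightarrow> complex vec \<Rightarrow> bool" where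
  "density_weights tol d N x ls w \<longleftrightarrow>
     (let A = fourier_mat N x ls;
          A' = map_mat cnj A;
          e0 = vec (length ls) (\<lambda>l. if ls ! l = 0\<^sub>v d then 1 else 0)
      in w \<in> carrier_vec N \<and>
         (if length ls \<le> N
          then \<exists>v \<in> carrier_vec (length ls).
                 l2_norm_vec ((transpose_mat A * A') *\<^sub>v v - e0) \<le> tol \<and> w = A' *\<^sub>v v
          else l2_norm_vec ((A' * transpose_mat A) *\<^sub>v w - A' *\<^sub>v e0) \<le> tol))"

end

theory Submission
  imports Defs
begin

text \<open>
  The entry of \<open>B = A\<^sup>* W A\<close> at the pair of frequencies \<open>(k, l)\<close> is
  \<open>\<Sum>j. w\<^sub>j e\<^bsup>2\<pi>i(l - k)x\<^sub>j\<^esup>\<close>, and a difference of two frequencies in \<open>[- M / 2, M / 2)\<^sup>d\<close> lies in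
  \<open>[- M, M)\<^sup>d\<close>. The moment conditions on the doubled index set therefore say that \<open>B = I + E\<close>, where
  every entry of \<open>E\<close> has modulus at most \<open>\<epsilon>\<close>
  (\<open>gram_entry_moment\<close>, \<open>freq_set_diff\<close>). By the Cauchy-Schwarz inequality such an \<open>E\<close> of size \<open>n\<close> has
  spectral norm at most \<open>\<epsilon> n\<close> (\<open>l2_norm_mult_entry_bound\<close>), so
  \<open>(1 - \<epsilon> n) \<parallel>v\<parallel> \<le> \<parallel>B v\<parallel> \<le> (1 + \<epsilon> n) \<parallel>v\<parallel>\<close> for all \<open>v\<close> (\<open>l2_norm_near_identity\<close>).
  If \<open>\<epsilon> n < 1\<close>, the lower bound makes \<open>B\<close> injective, hence
  invertible, and bounds the norm of the inverse by \<open>1 / (1 - \<epsilon> n)\<close>; the upper bound is a bound for the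
  norm of \<open>B\<close> itself (\<open>cond_num2_le\<close>).
\<close>

section \<open>The Euclidean norm and the spectral norm\<close>

lemma l2_norm_vec_nonneg [simp]: "0 \<le> l2_norm_vec v"
  by (simp add: l2_norm_vec_def)

lemma l2_norm_vec_eq_0_iff:
  assumes "v \<in> carrier_vec n"
  shows "l2_norm_vec v = 0 \<longleftrightarrow> v = 0\<^sub>v n"
  using assms by (auto simp: l2_norm_vec_def L2_set_eq_0_iff intro!: eq_vecI)

lemma l2_norm_vec_smult: "l2_norm_vec (c \<cdot>\<^sub>v v) = cmod c * l2_norm_vec v"
  by (simp add: l2_norm_vec_def L2_set_right_distrib norm_mult cong: L2_set_cong_simp)

lemma l2_norm_vec_triangle:
  assumes "u \<in> carrier_vec n" "v \<in> carrier_vec n"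
  shows "l2_norm_vec (u + v) \<le> l2_norm_vec u + l2_norm_vec v"
proof -
  have "l2_norm_vec (u + v) \<le> L2_set (\<lambda>i. cmod (u $ i) + cmod (v $ i)) {..<n}"
    using assms by (auto simp: l2_norm_vec_def intro!: L2_set_mono norm_triangle_ineq)
  also have "\<dots> \<le> L2_set (\<lambda>i. cmod (u $ i)) {..<n} + L2_set (\<lambda>i. cmod (v $ i)) {..<n}"
    by (rule L2_set_triangle_ineq)
  finally show ?thesis
    using assms by (simp add: l2_norm_vec_def)
qed

lemma ex_unit_vec:
  assumes "0 < n"
  shows "\<exists>v \<in> carrier_vec n. l2_norm_vec v = 1"
proof
  have "L2_set (\<lambda>i. cmod (unit_vec n 0 $ i)) {..<n} = sqrt (\<Sum>i<n. if i = 0 then 1 else 0)"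
    unfolding L2_set_def using assms by (intro arg_cong[of _ _ sqrt] sum.cong) auto
  also have "\<dots> = 1"
    using assms by (simp add: sum.delta)
  finally show "l2_norm_vec (unit_vec n 0) = 1"
    by (simp add: l2_norm_vec_def)
qed simp

text \<open>Cauchy-Schwarz in each row bounds the coordinates of \<open>X v\<close> by \<open>c \<surd>nc \<parallel>v\<parallel>\<close>; summing the squares
  over the rows contributes the factor \<open>\<surd>nr\<close>.\<close>

lemma l2_norm_mult_entry_bound:
  fixes X :: "complex mat"
  assumes X: "X \<in> carrier_mat nr nc" and v: "v \<in> carrier_vec nc" and c: "0 \<le> c"
    and entry: "\<And>i j. i < nr \<Longrightarrow> j < nc \<Longrightarrow> cmod (X $$ (i, j)) \<le> c"
  shows "l2_norm_vec (X *\<^sub>v v) \<le> c * (sqrt nr * sqrt nc) * l2_norm_vec v"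
proof -
  have row: "cmod ((X *\<^sub>v v) $ i) \<le> c * sqrt nc * l2_norm_vec v" if i: "i < nr" for i
  proof -
    have "(X *\<^sub>v v) $ i = (\<Sum>j<nc. X $$ (i, j) * v $ j)"
      using X v i by (auto simp: scalar_prod_def lessThan_atLeast0 intro!: sum.cong)
    also have "cmod \<dots> \<le> (\<Sum>j<nc. \<bar>c\<bar> * \<bar>cmod (v $ j)\<bar>)"
      using entry[OF i] c by (intro sum_norm_le) (simp add: norm_mult mult_right_mono)
    also have "\<dots> \<le> L2_set (\<lambda>j. c) {..<nc} * L2_set (\<lambda>j. cmod (v $ j)) {..<nc}"
      by (rule L2_set_mult_ineq)
    also have "\<dots> = c * sqrt nc * l2_norm_vec v"
      using c v by (simp add: L2_set_constant l2_norm_vec_def)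
    finally show ?thesis .
  qed
  have "l2_norm_vec (X *\<^sub>v v) \<le> L2_set (\<lambda>i. c * sqrt nc * l2_norm_vec v) {..<nr}"
    using X row by (auto simp: l2_norm_vec_def[of "X *\<^sub>v v"] simp del: index_mult_mat_vec
        intro!: L2_set_mono)
  also have "\<dots> = c * (sqrt nr * sqrt nc) * l2_norm_vec v"
    using c by (simp add: L2_set_constant)
  finally show ?thesis .
qed

lemma spectral_norm_le:
  assumes X: "X \<in> carrier_mat nr nc" and nc: "0 < nc"
    and bound: "\<And>v. v \<in> carrier_vec nc \<Longrightarrow> l2_norm_vec (X *\<^sub>v v) \<le> b * l2_norm_vec v"
  shows "spectral_norm X \<le> b"
  unfolding spectral_norm_def
proof (rule cSup_least)
  show "{l2_norm_vec (X *\<^sub>v v) |v. v \<in> carrier_vec (dim_col X) \<and> l2_norm_vec v = 1} \<noteq> {}"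
    using ex_unit_vec[OF nc] X by auto
next
  fix t
  assume "t \<in> {l2_norm_vec (X *\<^sub>v v) |v. v \<in> carrier_vec (dim_col X) \<and> l2_norm_vec v = 1}"
  then obtain v where "v \<in> carrier_vec nc" "l2_norm_vec v = 1" "t = l2_norm_vec (X *\<^sub>v v)"
    using X by auto
  then show "t \<le> b"
    using bound[of v] by simp
qed

text \<open>A supremum in \<open>\<real>\<close> is an upper bound only of a set that is bounded above. Here boundedness
  comes from the entrywise estimate, with the sum of all moduli as the bound for the entries.\<close>

lemma l2_norm_mult_le_spectral_norm:
  assumes X: "X \<in> carrier_mat nr nc" and v: "v \<in> carrier_vec nc"
  shows "l2_norm_vec (X *\<^sub>v v) \<le> spectral_norm X * l2_norm_vec v"
proof (cases "l2_norm_vec v = 0")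
  case True
  then have "v = 0\<^sub>v nc"
    using v by (simp add: l2_norm_vec_eq_0_iff)
  then have "X *\<^sub>v v = 0\<^sub>v nr"
    using X by (auto intro!: eq_vecI)
  then show ?thesis
    using True l2_norm_vec_eq_0_iff[of "0\<^sub>v nr" nr] by simp
next
  case False
  define S where
    "S = {l2_norm_vec (X *\<^sub>v u) |u. u \<in> carrier_vec (dim_col X) \<and> l2_norm_vec u = 1}"
  define c where "c = (\<Sum>p \<in> {..<nr} \<times> {..<nc}. cmod (X $$ p))"
  have entry: "cmod (X $$ (i, j)) \<le> c" if "i < nr" "j < nc" for i j
    unfolding c_def using that by (intro member_le_sum) auto
  have c: "0 \<le> c"
    unfolding c_def by (intro sum_nonneg) simp
  have bdd: "bdd_above S"
  proof (rule bdd_aboveI)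
    fix t assume "t \<in> S"
    then obtain u where "u \<in> carrier_vec nc" "l2_norm_vec u = 1" "t = l2_norm_vec (X *\<^sub>v u)"
      using X by (auto simp: S_def)
    then show "t \<le> c * (sqrt nr * sqrt nc)"
      using l2_norm_mult_entry_bound[OF X _ c entry, of u] by simp
  qed
  define r where "r = l2_norm_vec v"
  have r: "0 < r"
    using False by (simp add: r_def less_le)
  define u where "u = complex_of_real (1 / r) \<cdot>\<^sub>v v"
  have u: "u \<in> carrier_vec nc" "l2_norm_vec u = 1"
    using v r by (simp_all add: u_def l2_norm_vec_smult norm_divide flip: r_def)
  have "X *\<^sub>v u = complex_of_real (1 / r) \<cdot>\<^sub>v (X *\<^sub>v v)"
    unfolding u_def using mult_mat_vec[OF X v] .
  then have Xv: "l2_norm_vec (X *\<^sub>v v) = r * l2_norm_vec (X *\<^sub>v u)"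
    using r by (simp add: l2_norm_vec_smult norm_divide)
  have "l2_norm_vec (X *\<^sub>v u) \<le> spectral_norm X"
    unfolding spectral_norm_def S_def[symmetric]
    using u X by (intro cSup_upper bdd) (auto simp: S_def)
  then show ?thesis
    using r by (simp add: Xv mult.commute flip: r_def)
qed

section \<open>The condition number of a matrix with two-sided norm bounds\<close>

text \<open>The lower bound makes the kernel of \<open>B\<close> trivial, which for a square matrix means invertible;
  applied to \<open>B\<^sup>-\<^sup>1 v\<close> it reads \<open>\<parallel>B\<^sup>-\<^sup>1 v\<parallel> \<le> \<parallel>v\<parallel> / a\<close>. That the condition number is at
  least \<open>1\<close> is submultiplicativity, applied to \<open>B\<^sup>-\<^sup>1 B v = v\<close> for a unit vector \<open>v\<close>.\<close>

lemma cond_num2_le: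
  fixes B :: "complex mat"
  assumes B: "B \<in> carrier_mat n n" and n: "0 < n" and a: "0 < a"
    and lower: "\<And>v. v \<in> carrier_vec n \<Longrightarrow> a * l2_norm_vec v \<le> l2_norm_vec (B *\<^sub>v v)"
    and upper: "\<And>v. v \<in> carrier_vec n \<Longrightarrow> l2_norm_vec (B *\<^sub>v v) \<le> b * l2_norm_vec v"
  shows "invertible_mat B" "1 \<le> cond_num2 B" "cond_num2 B \<le> b / a"
proof -
  have "v = 0\<^sub>v n" if v: "v \<in> carrier_vec n" and "B *\<^sub>v v = 0\<^sub>v n" for v
  proof -
    have "a * l2_norm_vec v \<le> 0"
      using lower[OF v] that(2) l2_norm_vec_eq_0_iff[of "0\<^sub>v n" n] by simp
    then have "l2_norm_vec v = 0"
      using a by (simp add: mult_le_0_iff order.antisym)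
    then show ?thesis
      using v by (simp add: l2_norm_vec_eq_0_iff)
  qed
  then have "det B \<noteq> 0"
    using det_0_iff_vec_prod_zero[OF B] by auto
  then have "B \<in> Units (ring_mat TYPE(complex) n ())"
    by (rule det_non_zero_imp_unit[OF B])
  then obtain C where some: "mat_inverse B = Some C"
    using mat_inverse(1)[OF B, of "()"] by (cases "mat_inverse B") auto
  from mat_inverse(2)[OF B this]
  have BC: "B * C = 1\<^sub>m n" and CB: "C * B = 1\<^sub>m n" and C: "C \<in> carrier_mat n n"
    by auto
  show "invertible_mat B"
    unfolding invertible_mat_def inverts_mat_def using B C BC CB by auto
  have cond: "cond_num2 B = spectral_norm B * spectral_norm C"
    by (simp add: cond_num2_def some)

  have norm_C: "spectral_norm C \<le> 1 / a"
  proof (rule spectral_norm_le[OF C n])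
    fix v :: "complex vec" assume v: "v \<in> carrier_vec n"
    have "B *\<^sub>v (C *\<^sub>v v) = v"
      using B C v BC by (simp flip: assoc_mult_mat_vec)
    then show "l2_norm_vec (C *\<^sub>v v) \<le> 1 / a * l2_norm_vec v"
      using lower[of "C *\<^sub>v v"] C v a by (simp add: field_simps)
  qed
  have norm_B: "spectral_norm B \<le> b"
    by (rule spectral_norm_le[OF B n upper])

  obtain u where u: "u \<in> carrier_vec n" "l2_norm_vec u = 1"
    using ex_unit_vec[OF n] by blast
  have B0: "0 \<le> spectral_norm B"
    using l2_norm_mult_le_spectral_norm[OF B u(1)] u(2) l2_norm_vec_nonneg[of "B *\<^sub>v u"]
    by (metis mult.right_neutral order.trans)
  have C0: "0 \<le> spectral_norm C"
    using l2_norm_mult_le_spectral_norm[OF C u(1)] u(2) l2_norm_vec_nonneg[of "C *\<^sub>v u"]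
    by (metis mult.right_neutral order.trans)
  have "1 = l2_norm_vec (C *\<^sub>v (B *\<^sub>v u))"
    using B C u CB by (simp flip: assoc_mult_mat_vec)
  also have "\<dots> \<le> spectral_norm C * l2_norm_vec (B *\<^sub>v u)"
    using B u by (intro l2_norm_mult_le_spectral_norm[OF C]) auto
  also have "\<dots> \<le> spectral_norm C * spectral_norm B"
    using l2_norm_mult_le_spectral_norm[OF B u(1)] u(2) C0 by (intro mult_left_mono) auto
  finally show "1 \<le> cond_num2 B"
    by (simp add: cond mult.commute)
  have "spectral_norm B * spectral_norm C \<le> b * (1 / a)"
    using norm_B norm_C B0 C0 by (intro mult_mono) auto
  then show "cond_num2 B \<le> b / a"
    by (simp add: cond)
qed

text \<open>The perturbation \<open>E = B - I\<close> moves \<open>v\<close> by at most \<open>c n \<parallel>v\<parallel>\<close>, so both bounds are the triangle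
  inequality, read once for \<open>B v = v + E v\<close> and once for \<open>v = B v - E v\<close>.\<close>

lemma l2_norm_near_identity:
  fixes B :: "complex mat"
  assumes B: "B \<in> carrier_mat n n" and v: "v \<in> carrier_vec n" and c: "0 \<le> c"
    and entry: "\<And>i j. i < n \<Longrightarrow> j < n \<Longrightarrow> cmod (B $$ (i, j) - (if i = j then 1 else 0)) \<le> c"
  shows "(1 - c * n) * l2_norm_vec v \<le> l2_norm_vec (B *\<^sub>v v)"
    and "l2_norm_vec (B *\<^sub>v v) \<le> (1 + c * n) * l2_norm_vec v"
proof -
  define e where "e = (B - 1\<^sub>m n) *\<^sub>v v"
  have e: "e \<in> carrier_vec n"
    using B v by (auto simp: e_def intro!: mult_mat_vec_carrier)
  have "l2_norm_vec e \<le> c * (sqrt n * sqrt n) * l2_norm_vec v"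
    unfolding e_def
  proof (rule l2_norm_mult_entry_bound[OF _ v c])
    show "B - 1\<^sub>m n \<in> carrier_mat n n"
      by (rule minus_carrier_mat) simp
  next
    fix i j assume "i < n" "j < n"
    then show "cmod ((B - 1\<^sub>m n) $$ (i, j)) \<le> c"
      using entry[of i j] B by simp
  qed
  then have norm_e: "l2_norm_vec e \<le> c * n * l2_norm_vec v"
    by simp
  have e_eq: "e = B *\<^sub>v v - v"
    using B v by (simp add: e_def minus_mult_distrib_mat_vec)
  have Bv: "B *\<^sub>v v = v + e" and v_eq: "v = B *\<^sub>v v + (-1) \<cdot>\<^sub>v e"
    using B v by (auto simp: e_eq intro!: eq_vecI)
  have "l2_norm_vec (B *\<^sub>v v) \<le> l2_norm_vec v + l2_norm_vec e"
    unfolding Bv using v e by (rule l2_norm_vec_triangle)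
  then show "l2_norm_vec (B *\<^sub>v v) \<le> (1 + c * n) * l2_norm_vec v"
    using norm_e by (simp add: algebra_simps)
  have "l2_norm_vec v \<le> l2_norm_vec (B *\<^sub>v v) + l2_norm_vec ((-1) \<cdot>\<^sub>v e)"
    using B v e by (subst (1) v_eq, intro l2_norm_vec_triangle) auto
  then show "(1 - c * n) * l2_norm_vec v \<le> l2_norm_vec (B *\<^sub>v v)"
    using norm_e by (simp add: l2_norm_vec_smult algebra_simps)
qed

section \<open>The weighted Gram matrix of the characters\<close>

lemma zero_in_freq_set: "0 < M \<Longrightarrow> 0\<^sub>v d \<in> freq_set d M"
  by (simp add: freq_set_def)

lemma freq_set_diff:
  assumes "k \<in> freq_set d M" "l \<in> freq_set d M"
  shows "l - k \<in> freq_set d (2 * M)"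
proof -
  have k: "k \<in> carrier_vec d" and l: "l \<in> carrier_vec d"
    using assms by (auto simp: freq_set_def)
  have "- (real (2 * M) / 2) \<le> real_of_int ((l - k) $ i) \<and>
        real_of_int ((l - k) $ i) < real (2 * M) / 2" if i: "i < d" for i
  proof -
    have "- (real M / 2) \<le> real_of_int (k $ i)" "real_of_int (k $ i) < real M / 2"
      "- (real M / 2) \<le> real_of_int (l $ i)" "real_of_int (l $ i) < real M / 2"
      using assms i by (auto simp: freq_set_def)
    moreover have "(l - k) $ i = l $ i - k $ i"
      using k i by simp
    ultimately show ?thesis
      by simp
  qed
  then show ?thesis
    using k l by (auto simp: freq_set_def)
qed

lemma fourier_char_diff:
  assumes "k \<in> carrier_vec d" "l \<in> carrier_vec d" "y \<in> carrier_vec d"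
  shows "fourier_char (l - k) y = cnj (fourier_char k y) * fourier_char l y"
proof -
  have "map_vec real_of_int (l - k) = map_vec real_of_int l - map_vec real_of_int k"
    using assms by (auto intro!: eq_vecI)
  then have inner: "map_vec real_of_int (l - k) \<bullet> y
      = map_vec real_of_int l \<bullet> y - map_vec real_of_int k \<bullet> y"
    using assms by (simp add: minus_scalar_prod_distrib[of _ d])
  have "fourier_char h y = cis (2 * pi * (map_vec real_of_int h \<bullet> y))" for h
    by (simp add: fourier_char_def cis_conv_exp mult_ac)
  then show ?thesis
    by (simp add: inner cis_cnj cis_mult right_diff_distrib)
qed

lemma fourier_mat_carrier: "fourier_mat N x ks \<in> carrier_mat N (length ks)"
  by (simp add: fourier_mat_def)

lemma mat_adjoint_carrier:
  "A \<in> carrier_mat nr nc \<Longrightarrow> mat_adjoint A \<in> carrier_mat nc nr"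
  by (auto simp: mat_adjoint_def)

lemma weighted_gram_entry:
  fixes A :: "complex mat"
  assumes A: "A \<in> carrier_mat N n" and k: "k < n" and l: "l < n"
  shows "(mat_adjoint A * mat_diag N f * A) $$ (k, l)
    = (\<Sum>j<N. cnj (A $$ (j, k)) * f j * A $$ (j, l))"
proof -
  have adj: "mat_adjoint A $$ (k, j) = cnj (A $$ (j, k))" if "j < N" for j
    using A k that by (simp add: mat_adjoint_def mat_of_rows_index)
  show ?thesis
    using A k l mat_adjoint_carrier[OF A]
    by (auto simp: mat_diag_mult_right[OF mat_adjoint_carrier[OF A]] scalar_prod_def adj
        lessThan_atLeast0 intro!: sum.cong)
qed

text \<open>Conjugating a character negates its frequency, so each entry of the weighted Gram matrix is a
  single exponential moment of the weights.\<close>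

lemma gram_entry_moment:
  assumes x: "\<And>j. j < N \<Longrightarrow> x j \<in> carrier_vec d" and ks: "set ks \<subseteq> carrier_vec d"
    and k: "k < length ks" and l: "l < length ks"
  shows "(mat_adjoint (fourier_mat N x ks) * mat_diag N f * fourier_mat N x ks) $$ (k, l)
    = (\<Sum>j<N. f j * fourier_char (ks ! l - ks ! k) (x j))"
proof -
  have "ks ! k \<in> carrier_vec d" "ks ! l \<in> carrier_vec d"
    using ks k l by (auto dest: nth_mem)
  then show ?thesis
    unfolding weighted_gram_entry[OF fourier_mat_carrier k l]
    using x k l
    by (intro sum.cong) (auto simp: fourier_mat_def fourier_char_diff)
qed

section \<open>The condition number of the weighted Gram matrix\<close>

theorem theorem3p15:
  fixes d N M :: nat
    and x :: "nat \<Rightarrow> real vec"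
    and ks ls :: "int vec list"
    and w :: "complex vec"
    and eps :: "int vec \<Rightarrow> real"
    and \<epsilon> tol :: real
    and A W :: "complex mat"
  assumes "1 \<le> d" and "1 \<le> N" and "even M" and "0 < M"
    and "\<And>j. j < N \<Longrightarrow> x j \<in> carrier_vec d"
    and "\<And>j i. j < N \<Longrightarrow> i < d \<Longrightarrow> x j $ i \<in> {- (1 / 2)..<1 / 2}"
    and "distinct ks" and "set ks = freq_set d M"
    and "distinct ls" and "set ls = freq_set d (2 * M)"
    and "A = fourier_mat N x ks"
    and "W = mat_diag N (\<lambda>j. w $ j)"
    and "density_weights tol d N x ls w"
    and "\<And>k. k \<in> freq_set d (2 * M) \<Longrightarrow>
           (\<Sum>j<N. w $ j * fourier_char k (x j)) =
             (if k = 0\<^sub>v d then 1 else 0) + complex_of_real (eps k)"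
    and "\<epsilon> = Max ((\<lambda>k. \<bar>eps k\<bar>) ` freq_set d (2 * M))"
    and "\<epsilon> * real (card (freq_set d M)) < 1"
  shows "invertible_mat (mat_adjoint A * W * A) \<and>
         1 \<le> cond_num2 (mat_adjoint A * W * A) \<and>
         cond_num2 (mat_adjoint A * W * A) \<le>
           (1 + \<epsilon> * real (card (freq_set d M))) / (1 - \<epsilon> * real (card (freq_set d M)))"
proof -
  note x = assms(5) and ks = assms(7,8) and moment = assms(14)
  define n where "n = length ks"
  define B where "B = mat_adjoint A * W * A"
  have card: "card (freq_set d M) = n"
    using ks by (simp add: n_def distinct_card flip: ks(2))
  have n: "0 < n"
    using zero_in_freq_set[OF \<open>0 < M\<close>, of d] ks(2) by (auto simp: n_def)
  have ks_carrier: "set ks \<subseteq> carrier_vec d"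
    unfolding ks(2) by (auto simp: freq_set_def)
  have A: "A \<in> carrier_mat N n"
    unfolding assms(11) n_def by (rule fourier_mat_carrier)
  have B: "B \<in> carrier_mat n n"
    using A mat_adjoint_carrier[OF A] by (auto simp: B_def assms(12))

  have finite: "finite (freq_set d (2 * M))"
    by (simp flip: assms(10))
  have eps_le: "\<bar>eps k\<bar> \<le> \<epsilon>" if "k \<in> freq_set d (2 * M)" for k
    unfolding assms(15) using finite that by (intro Max_ge) auto
  have eps0: "0 \<le> \<epsilon>"
    using eps_le[OF zero_in_freq_set] \<open>0 < M\<close> by fastforce

  have entry: "cmod (B $$ (k, l) - (if k = l then 1 else 0)) \<le> \<epsilon>"
    if k: "k < n" and l: "l < n" for k l
  proof -
    define m where "m = ks ! l - ks ! k"
    have mem: "ks ! k \<in> freq_set d M" "ks ! l \<in> freq_set d M"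
      using k l by (simp_all add: n_def flip: ks(2))
    then have carrier: "ks ! k \<in> carrier_vec d" "ks ! l \<in> carrier_vec d"
      by (simp_all add: freq_set_def)
    have m: "m \<in> freq_set d (2 * M)"
      unfolding m_def using mem by (rule freq_set_diff)
    have "m = 0\<^sub>v d \<longleftrightarrow> ks ! l = ks ! k"
    proof
      assume "m = 0\<^sub>v d"
      then have "(ks ! l - ks ! k) $ i = 0" if "i < d" for i
        using that by (simp add: m_def)
      then show "ks ! l = ks ! k"
        using carrier by (intro eq_vecI) auto
    qed (use carrier in \<open>simp add: m_def\<close>)
    \<comment> \<open>The frequencies are listed without repetition, so only the diagonal belongs to frequency zero.\<close>
    also have "\<dots> \<longleftrightarrow> k = l"
      using ks(1) k l by (auto simp: n_def nth_eq_iff_index_eq)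
    finally have m0: "m = 0\<^sub>v d \<longleftrightarrow> k = l" .
    have "B $$ (k, l) = (\<Sum>j<N. w $ j * fourier_char m (x j))"
      unfolding B_def assms(11,12) m_def
      using k l by (intro gram_entry_moment[OF x ks_carrier]) (simp_all add: n_def)
    also have "\<dots> = (if k = l then 1 else 0) + complex_of_real (eps m)"
      using moment[OF m] m0 by simp
    finally show ?thesis
      using eps_le[OF m] by simp
  qed

  have "0 < 1 - \<epsilon> * n"
    using assms(16) by (simp add: card)
  from cond_num2_le[OF B n this l2_norm_near_identity[OF B _ eps0 entry]]
  show ?thesis
    unfolding B_def[symmetric] card by simp
qed

end
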